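(* Let $S$ be a set of $n$ points in the plane in convex position. Then the number of non-crossing path partitions without singletons (ncpws partitions) that $S$ admits is $\mathcal{O}^*(4.610718614^n)$.
   Context: A non-crossing graph on a finite point set $S$ in the plane is a graph with vertex set $S$ whose edges are straight line segments, no two of which cross. A non-crossing path partition without singletons (ncpws partition) of $S$ is a non-crossing graph on $S$ every connected component of which is a path with at least one edge (i.e. every point of $S$ belongs to a path of length at least $1$; no isolated vertices). The notation $\mathcal{O}^*(c^n)$ means $O(p(n)\,c^n)$ for some polynomial $p$, i.e. polynomial factors are neglected. *)

theory Defs
  imports "HOL-Analysis.Analysis"
begin

type_synonym point = "real \<times> real"

definition convex_position :: "point set \<Rightarrow> bool" where
  "convex_position S \<longleftrightarrow> (\<forall>p\<in>S. p \<notin> convex hull (S - {p}))"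

definition straight_graph :: "point set \<Rightarrow> point set set \<Rightarrow> bool" where
  "straight_graph S E \<longleftrightarrow> (\<forall>e\<in>E. \<exists>a b. a \<in> S \<and> b \<in> S \<and> a \<noteq> b \<and> e = {a, b})"

definition edge_seg :: "point set \<Rightarrow> point set" where
  "edge_seg e = convex hull e"

definition non_crossing :: "point set set \<Rightarrow> bool" where
  "non_crossing E \<longleftrightarrow> (\<forall>e\<in>E. \<forall>f\<in>E. e \<noteq> f \<longrightarrow> edge_seg e \<inter> edge_seg f \<subseteq> e \<inter> f)"

definition adj :: "point set set \<Rightarrow> (point \<times> point) set" where
  "adj E = {(u, v). {u, v} \<in> E}"

definition component :: "point set set \<Rightarrow> point \<Rightarrow> point set" where
  "component E v = {w. (v, w) \<in> (adj E)\<^sup>*}"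

definition path_edges :: "point list \<Rightarrow> point set set" where
  "path_edges vs = {{vs ! i, vs ! Suc i} | i. Suc i < length vs}"

definition component_is_path :: "point set set \<Rightarrow> point \<Rightarrow> bool" where
  "component_is_path E v \<longleftrightarrow>
     (\<exists>vs. distinct vs \<and> length vs \<ge> 2 \<and> set vs = component E v \<and>
           {e \<in> E. e \<subseteq> component E v} = path_edges vs)"

definition ncpws :: "point set \<Rightarrow> point set set \<Rightarrow> bool" where
  "ncpws S E \<longleftrightarrow> straight_graph S E \<and> non_crossing E \<and> (\<forall>v\<in>S. component_is_path E v)"

end

theory Submission
  imports Defs
begin

text \<open>
  The vertex sets of the paths form a non-crossing partition of the points in their cyclic order.
  Such a partition is determined by the function that assigns to the first point of every block the
  size of the block and 0 to all other points. A block of k >= 2 points carries at most k * 2^k / 8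
  non-crossing spanning paths. The values of the function add up to at most n, so for every y with
  0 < 2 y < 1 the number of graphs is at most (C(y) / y)^n, where
  C(y) = 1 + (sum over k >= 2 of k * (2 y)^k) / 8 = 1 + (2 y / (1 - 2 y)^2 - 2 y) / 8.
  The minimum of C(y) / y is 4.6107186132...
\<close>

section \<open>Points in convex position\<close>

text \<open>Convex position is given by hulls only, so the cyclic order must first be produced: an
  injection \<open>f\<close> into the natural numbers under which alternating pairs of points span
  crossing segments. After that the argument concerns \<open>f\<close>-values alone. It is not
  necessary to know which functions are codes of graphs, only that graphs with equal codes have
  equal components; the codes are then overcounted by all functions with values 0 or at least 2 and
  total at most n. This is cheap: by the cycle lemma every sequence of n nonnegative integers with
  total n has a rotation that satisfies the partial-sum condition of a code, so at most a factor n
  is lost among these. The number of graphs with a given code is bounded by a product over the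
  points, which is why non-first points get weight 1. For 0 < y < 1, inserting the factor y^(total -
  n) >= 1 makes it affordable to drop the condition on the total, and what is left factorises into
  an n-th power.\<close>

definition orient :: "point \<Rightarrow> point \<Rightarrow> point \<Rightarrow> real" where
  "orient a b c = (fst b - fst a) * (snd c - snd a) - (snd b - snd a) * (fst c - fst a)"

text \<open>\<open>orient a b c\<close> is twice the signed area of the triangle abc, positive when
  it runs counterclockwise; as a function of its last argument it is affine.\<close>

lemma orient_convex_comb:
  assumes "u + v = 1"
  shows "orient p q (u *\<^sub>R r + v *\<^sub>R s) = u * orient p q r + v * orient p q s"
proof -
  have v: "v = 1 - u" using assms by simp
  show ?thesis unfolding orient_def v by (simp add: algebra_simps)
qed

lemma orient_segment:
  assumes "x \<in> convex hull {r, s}"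
  obtains u where "0 \<le> u" "u \<le> 1" "orient p q x = (1 - u) * orient p q r + u * orient p q s"
proof -
  obtain u where "0 \<le> u" "u \<le> 1" "x = (1 - u) *\<^sub>R r + u *\<^sub>R s"
    using assms by (auto simp: segment_convex_hull[symmetric] closed_segment_def)
  then show thesis using that[of u] orient_convex_comb[of "1 - u" u p q r s] by simp
qed

lemma orient_on_line:
  assumes "x \<in> convex hull {p, q}"
  shows "orient p q x = 0"
proof -
  obtain u where "orient p q x = (1 - u) * orient p q p + u * orient p q q"
    using orient_segment[OF assms, of p q] by metis
  then show ?thesis by (simp add: orient_def)
qed

text \<open>An affine function that vanishes on one segment and has the same strict sign at both
  ends of the other has no zero on the latter.\<close>

lemma segments_disjoint_if_same_side:
  assumes "orient p q r * orient p q s > 0"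
  shows "convex hull {p, q} \<inter> convex hull {r, s} = {}"
proof (rule ccontr)
  assume "\<not> ?thesis"
  then obtain x where x: "x \<in> convex hull {p, q}" "x \<in> convex hull {r, s}" by blast
  obtain u where u: "0 \<le> u" "u \<le> 1" "orient p q x = (1 - u) * orient p q r + u * orient p q s"
    using orient_segment[OF x(2), of p q] by metis
  have z: "(1 - u) * orient p q r + u * orient p q s = 0"
    using orient_on_line[OF x(1)] u(3) by simp
  consider "orient p q r > 0" "orient p q s > 0" | "orient p q r < 0" "orient p q s < 0"
    using assms by (auto simp: zero_less_mult_iff)
  then show False
  proof cases
    case 1
    then show False using u z
      by (smt (verit) mult_pos_pos mult_nonneg_nonneg)
  next
    case 2
    then show False using u z
      by (smt (verit) mult_pos_neg mult_nonneg_nonpos)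
  qed
qed

text \<open>Of three collinear points one lies between the other two, hence in the hull of the rest
  of \<open>S\<close>.\<close>

lemma orient_nonzero:
  assumes S: "convex_position S" and abc: "a \<in> S" "b \<in> S" "c \<in> S" "a \<noteq> b" "a \<noteq> c" "b \<noteq> c"
  shows "orient a b c \<noteq> 0"
proof
  assume o: "orient a b c = 0"
  have "\<exists>t. c - a = t *\<^sub>R (b - a)"
  proof (cases "fst b - fst a = 0")
    case True
    with abc have ne: "snd b - snd a \<noteq> 0" by (auto simp: prod_eq_iff)
    with o True have "fst c - fst a = 0" by (simp add: orient_def)
    with True ne show ?thesis
      by (intro exI[of _ "(snd c - snd a) / (snd b - snd a)"]) (simp add: prod_eq_iff)
  next
    case False
    with o have "snd c - snd a = (fst c - fst a) / (fst b - fst a) * (snd b - snd a)"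
      by (simp add: orient_def divide_simps mult.commute)
    with False show ?thesis
      by (intro exI[of _ "(fst c - fst a) / (fst b - fst a)"]) (simp add: prod_eq_iff)
  qed
  then obtain t where "c = (1 - t) *\<^sub>R a + t *\<^sub>R b" by (auto simp: algebra_simps)
  then have "collinear {b, c, a}"
    using collinear_3_expand[of b c a] by (metis add.commute)
  then have "a \<in> convex hull {b, c} \<or> b \<in> convex hull {a, c} \<or> c \<in> convex hull {a, b}"
    by (auto simp: collinear_between_cases between_mem_segment segment_convex_hull insert_commute)
  moreover have "x \<notin> convex hull {y, z}" if "x \<in> S" "y \<in> S" "z \<in> S" "x \<noteq> y" "x \<noteq> z" for x y z
    using S that hull_mono[of "{y, z}" "S - {x}" convex] unfolding convex_position_def by auto
  ultimately show False using abc by metis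
qed

text \<open>Four points of the plane have a Radon partition. A split 1+3 would put one point into
  the hull of the others, so the split is 2+2, and there are three ways to pair the points.\<close>

lemma convex_quadrilateral_diagonals:
  assumes S: "convex_position S"
    and abcd: "a \<in> S" "b \<in> S" "c \<in> S" "d \<in> S" "distinct [a, b, c, d]"
  shows "convex hull {a, b} \<inter> convex hull {c, d} \<noteq> {} \<or>
         convex hull {a, c} \<inter> convex hull {b, d} \<noteq> {} \<or>
         convex hull {a, d} \<inter> convex hull {b, c} \<noteq> {}"
proof -
  let ?Q = "{a, b, c, d}"
  have "card ?Q = 4" using abcd by simp
  then have "affine_dependent ?Q" by (intro affine_dependent_biggerset) auto
  then obtain M N where MN: "M \<inter> N = {}" "M \<union> N = ?Q" "convex hull M \<inter> convex hull N \<noteq> {}"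
    using Radon_partition[of ?Q] by auto
  have sing: False if "X \<inter> Y = {}" "X \<union> Y = ?Q" "convex hull X \<inter> convex hull Y \<noteq> {}" "X = {x}" for X Y x
  proof -
    have "x \<in> S" "Y \<subseteq> S - {x}" using that abcd by auto
    moreover have "x \<in> convex hull Y" using that by auto
    ultimately show False
      using S hull_mono[of Y "S - {x}" convex] unfolding convex_position_def by auto
  qed
  have card: "card M + card N = 4"
    using MN \<open>card ?Q = 4\<close> card_Un_disjoint[of M N] finite_subset[of M ?Q] finite_subset[of N ?Q] by auto
  have fin: "finite M" "finite N" using MN finite_subset[of M ?Q] finite_subset[of N ?Q] by auto
  have "card M \<noteq> 0" "card N \<noteq> 0" using MN(3) fin by auto
  moreover have "card M \<noteq> 1" "card N \<noteq> 1"
    using sing[of M N] sing[of N M] MN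
    by (metis card_1_singletonE, metis Int_commute Un_commute card_1_singletonE)
  ultimately have "card M = 2" "card N = 2" using card by auto
  then obtain p q where M: "M = {p, q}" "p \<noteq> q" unfolding card_2_iff by blast
  have "N = ?Q - M" using MN(1,2) by blast
  then have N: "N = ?Q - {p, q}" using M(1) by simp
  have "M \<subseteq> ?Q" using MN(2) by blast
  then have pq: "p \<in> ?Q" "q \<in> ?Q" using M(1) by simp_all
  have "{p, q} \<in> {{a, b}, {a, c}, {a, d}, {b, c}, {b, d}, {c, d}}"
    using pq M(2) abcd(5) by (elim insertE emptyE) (simp_all add: doubleton_eq_iff)
  moreover have "?Q - {a, b} = {c, d}" "?Q - {a, c} = {b, d}" "?Q - {a, d} = {b, c}"
    "?Q - {b, c} = {a, d}" "?Q - {b, d} = {a, c}" "?Q - {c, d} = {a, b}"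
    using abcd(5) by auto
  moreover have "convex hull {p, q} \<inter> convex hull (?Q - {p, q}) \<noteq> {}"
    using MN(3) M(1) N by simp
  ultimately show ?thesis by (elim insertE emptyE) (simp_all add: Int_commute)
qed

text \<open>Turning about a point is a cyclic relation in general. It is transitive here because the
  other points lie in a half-plane with \<open>a\<close> on its border, of which only one border ray
  is included.\<close>

lemma orient_trans_about_min:
  assumes "fst a < fst x \<or> fst a = fst x \<and> snd a < snd x"
    and "fst a < fst y \<or> fst a = fst y \<and> snd a < snd y"
    and "fst a < fst z \<or> fst a = fst z \<and> snd a < snd z"
    and xy: "orient a x y > 0" and yz: "orient a y z > 0"
  shows "orient a x z > 0"
proof -
  define u1 u2 v1 v2 w1 w2 where defs: "u1 = fst x - fst a" "u2 = snd x - snd a"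
    "v1 = fst y - fst a" "v2 = snd y - snd a" "w1 = fst z - fst a" "w2 = snd z - snd a"
  have pos: "u1 > 0 \<or> u1 = 0 \<and> u2 > 0" "v1 > 0 \<or> v1 = 0 \<and> v2 > 0" "w1 > 0 \<or> w1 = 0 \<and> w2 > 0"
    using assms defs by auto
  have xy': "u1 * v2 - u2 * v1 > 0" and yz': "v1 * w2 - v2 * w1 > 0"
    using xy yz by (simp_all add: orient_def defs)
  have w1: "w1 \<ge> 0" using pos(3) by auto
  have v1: "v1 > 0"
  proof (rule ccontr)
    assume "\<not> v1 > 0"
    with pos(2) have "v1 = 0" "v2 > 0" by auto
    with yz' w1 show False by (simp add: mult_less_0_iff)
  qed
  have u1: "u1 > 0"
  proof (rule ccontr)
    assume "\<not> u1 > 0"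
    with pos(1) have "u1 = 0" "u2 > 0" by auto
    with xy' v1 show False by (simp add: mult_less_0_iff)
  qed
  \<comment> \<open>This identity expresses the wanted determinant by the two given ones, with
    coefficients whose signs are known.\<close>
  have "v1 * (u1 * w2 - u2 * w1) = u1 * (v1 * w2 - v2 * w1) + w1 * (u1 * v2 - u2 * v1)"
    by (simp add: algebra_simps)
  also have "\<dots> > 0" using u1 w1 xy' yz' by (intro add_pos_nonneg) auto
  finally have "u1 * w2 - u2 * w1 > 0" using v1 by (simp add: zero_less_mult_iff)
  then show ?thesis by (simp add: orient_def defs)
qed

lemma orient_rotate: "orient a b c = orient b c a"
  and orient_swap: "orient a c b = - orient a b c"
  by (simp_all add: orient_def algebra_simps)

text \<open>The points are sorted by angle about the lexicographically smallest one; then every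
  increasing triple is positively oriented.\<close>

lemma convex_position_key:
  assumes fin: "finite S" and S: "convex_position S"
  obtains f :: "point \<Rightarrow> nat" where "inj_on f S"
    and "\<And>x y z. x \<in> S \<Longrightarrow> y \<in> S \<Longrightarrow> z \<in> S \<Longrightarrow> f x < f y \<Longrightarrow> f y < f z \<Longrightarrow> orient x y z > 0"
proof (cases "S = {}")
  case True
  then show thesis using that[of "\<lambda>_. 0"] by auto
next
  case False
  define m where "m = Min (fst ` S)"
  define S1 where "S1 = {x \<in> S. fst x = m}"
  have m: "m \<in> fst ` S" "\<And>x. x \<in> S \<Longrightarrow> m \<le> fst x" using fin False by (auto simp: m_def)
  then have S1: "finite (snd ` S1)" "snd ` S1 \<noteq> {}" using fin by (auto simp: S1_def)
  then obtain a where a: "a \<in> S1" "snd a = Min (snd ` S1)" using Min_in by (metis (no_types, lifting) imageE)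
  have aS: "a \<in> S" using a by (auto simp: S1_def)
  have lex: "fst a < fst x \<or> fst a = fst x \<and> snd a < snd x" if x: "x \<in> S" "x \<noteq> a" for x
  proof (cases "fst x = m")
    case True
    then have "snd a \<le> snd x" using S1 a x by (auto simp: S1_def)
    then show ?thesis using True a x by (auto simp: S1_def prod_eq_iff)
  next
    case False
    then show ?thesis using m(2)[OF x(1)] a by (auto simp: S1_def)
  qed
  define less where "less x y \<longleftrightarrow> y \<noteq> a \<and> (x = a \<or> orient a x y > 0)" for x y
  have irrefl: "\<not> less x x" for x by (auto simp: less_def orient_def)
  have trans: "less x z" if "less x y" "less y z" "x \<in> S" "y \<in> S" "z \<in> S" for x y z
    using that orient_trans_about_min[OF lex lex lex, of x y z] by (auto simp: less_def)
  have total: "less x y \<or> less y x" if "x \<in> S" "y \<in> S" "x \<noteq> y" for x y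
    using that orient_nonzero[OF S aS that(1,2)] orient_swap[of a x y]
    by (cases "a = x"; cases "a = y") (auto simp: less_def)
  \<comment> \<open>The rank in the strict linear order \<open>less\<close>, whose first element is
    \<open>a\<close>.\<close>
  define f where "f x = card {y \<in> S. less y x}" for x
  have mono: "f x < f y" if "x \<in> S" "y \<in> S" "less x y" for x y
  proof -
    have "{z \<in> S. less z x} \<subset> {z \<in> S. less z y}"
      using trans[of _ x y] that irrefl[of x] by blast
    then show ?thesis unfolding f_def using fin by (intro psubset_card_mono) auto
  qed
  have less: "less x y" if "x \<in> S" "y \<in> S" "f x < f y" for x y
  proof (rule ccontr)
    assume "\<not> less x y"
    moreover have "x \<noteq> y" using that(3) by auto
    ultimately have "less y x" using total that(1,2) by blast
    then show False using mono[OF that(2,1)] that(3) by simp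
  qed
  have inj: "inj_on f S"
  proof (rule inj_onI, rule ccontr)
    fix x y assume xy: "x \<in> S" "y \<in> S" "f x = f y" "x \<noteq> y"
    then have "less x y \<or> less y x" using total by simp
    then show False using mono[of x y] mono[of y x] xy by auto
  qed
  have "orient x y z > 0" if xyz: "x \<in> S" "y \<in> S" "z \<in> S" and lt: "f x < f y" "f y < f z" for x y z
  proof (cases "x = a")
    case True
    then show ?thesis using less[of y z] less[of x y] xyz lt by (auto simp: less_def)
  next
    case False
    have l: "less x y" "less y z" "less x z"
      using less[OF xyz(1,2)] less[OF xyz(2,3)] less[OF xyz(1,3)] lt by simp_all
    then have o: "orient a x y > 0" "orient a y z > 0" "orient a x z > 0" and ne: "y \<noteq> a" "z \<noteq> a"
      using False by (auto simp: less_def)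
    have d: "distinct [a, x, y, z]" using False ne lt by auto
    \<comment> \<open>Two of the three pairings are excluded by sides, so ay meets xz in some
      \<open>w\<close>. There \<open>orient x z\<close> is 0 while it is positive at
      \<open>a\<close>, so it cannot be positive at \<open>y\<close>.\<close>
    have "convex hull {a, x} \<inter> convex hull {y, z} = {}"
      using segments_disjoint_if_same_side[of a x y z] o by simp
    moreover have "convex hull {a, z} \<inter> convex hull {x, y} = {}"
      using segments_disjoint_if_same_side[of a z x y] o orient_swap[of a z x] orient_swap[of a z y]
      by (simp add: mult_neg_neg)
    ultimately have "convex hull {a, y} \<inter> convex hull {x, z} \<noteq> {}"
      using convex_quadrilateral_diagonals[OF S aS xyz d] by simp
    then obtain w where w: "w \<in> convex hull {a, y}" "w \<in> convex hull {x, z}" by auto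
    obtain u where u: "0 \<le> u" "u \<le> 1" "orient x z w = (1 - u) * orient x z a + u * orient x z y"
      using orient_segment[OF w(1), of x z] by metis
    have "orient x z w = 0" using orient_on_line w(2) by simp
    moreover have "orient x z a > 0" using o orient_rotate[of a x z] by simp
    moreover have "orient x y z \<noteq> 0" using orient_nonzero[OF S] xyz d by simp
    ultimately show ?thesis using u orient_swap[of x z y]
      by (smt (verit) mult_nonneg_nonneg mult_pos_pos)
  qed
  with inj show thesis by (rule that)
qed

text \<open>The only geometric fact that the counting uses. Orientation excludes two of the three
  pairings of the four points, so the remaining pair of segments must meet.\<close>

lemma convex_position_crossing_key:
  assumes fin: "finite S" and S: "convex_position S"
  obtains f :: "point \<Rightarrow> nat" where "inj_on f S"
    and "\<And>w x y z. w \<in> S \<Longrightarrow> x \<in> S \<Longrightarrow> y \<in> S \<Longrightarrow> z \<in> S \<Longrightarrow> f w < f x \<Longrightarrow> f x < f y \<Longrightarrow> f y < f z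
      \<Longrightarrow> convex hull {w, y} \<inter> convex hull {x, z} \<noteq> {}"
proof -
  obtain f :: "point \<Rightarrow> nat" where f: "inj_on f S"
    "\<And>x y z. x \<in> S \<Longrightarrow> y \<in> S \<Longrightarrow> z \<in> S \<Longrightarrow> f x < f y \<Longrightarrow> f y < f z \<Longrightarrow> orient x y z > 0"
    using convex_position_key[OF fin S] by metis
  have "convex hull {w, y} \<inter> convex hull {x, z} \<noteq> {}"
    if S4: "w \<in> S" "x \<in> S" "y \<in> S" "z \<in> S" and lt: "f w < f x" "f x < f y" "f y < f z" for w x y z
  proof -
    have "orient w x y > 0" "orient w x z > 0" "orient w y z > 0"
      using f(2) S4 lt by auto
    then have "convex hull {w, x} \<inter> convex hull {y, z} = {}" "convex hull {w, z} \<inter> convex hull {x, y} = {}"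
      using segments_disjoint_if_same_side[of w x y z] segments_disjoint_if_same_side[of w z x y]
        orient_swap[of w z x] orient_swap[of w z y] by (simp_all add: mult_neg_neg)
    moreover have "distinct [w, x, y, z]" using lt by auto
    ultimately show ?thesis using convex_quadrilateral_diagonals[OF S S4] by simp
  qed
  with f(1) show thesis by (rule that)
qed

section \<open>Non-crossing paths on a block\<close>

text \<open>One chain of inequalities covers every alternation, since the quantifiers run over both
  namings of each edge and both orders of the two edges.\<close>

definition crossing_free :: "(point \<Rightarrow> nat) \<Rightarrow> point set set \<Rightarrow> bool" where
  "crossing_free f E \<longleftrightarrow> (\<forall>a b c d. {a, c} \<in> E \<longrightarrow> {b, d} \<in> E \<longrightarrow> \<not> (f a < f b \<and> f b < f c \<and> f c < f d))"

lemma crossing_free_mono: "crossing_free f E \<Longrightarrow> F \<subseteq> E \<Longrightarrow> crossing_free f F"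
  unfolding crossing_free_def by blast

lemma list_consecutive_change:
  assumes "x \<in> set zs" "y \<in> set zs" "P x" "\<not> P y"
  shows "\<exists>i. Suc i < length zs \<and> P (zs ! i) \<noteq> P (zs ! Suc i)"
proof (rule ccontr)
  assume "\<not> ?thesis"
  then have step: "P (zs ! i) = P (zs ! Suc i)" if "Suc i < length zs" for i using that by blast
  have "i < length zs \<Longrightarrow> P (zs ! i) = P (zs ! 0)" for i
    by (induction i) (use step in auto)
  then show False using assms by (metis in_set_conv_nth)
qed

lemma path_edges_Cons: "path_edges vs \<subseteq> path_edges (v # vs)"
proof
  fix e assume "e \<in> path_edges vs"
  then obtain i where "Suc i < length vs" "e = {vs ! i, vs ! Suc i}" by (auto simp: path_edges_def)
  then show "e \<in> path_edges (v # vs)"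
    unfolding path_edges_def by (intro CollectI exI[of _ "Suc i"]) simp
qed

lemma path_edges_rev: "path_edges (rev vs) = path_edges vs"
proof -
  have sub: "path_edges (rev ws) \<subseteq> path_edges ws" for ws :: "point list"
  proof
    fix e assume "e \<in> path_edges (rev ws)"
    then obtain i where i: "Suc i < length ws" "e = {rev ws ! i, rev ws ! Suc i}"
      by (auto simp: path_edges_def)
    define j where "j = length ws - Suc (Suc i)"
    have "rev ws ! i = ws ! Suc j" "rev ws ! Suc i = ws ! j" "Suc j < length ws"
      using i by (auto simp: rev_nth j_def Suc_diff_Suc)
    then show "e \<in> path_edges ws" using i by (auto simp: path_edges_def)
  qed
  show ?thesis using sub[of vs] sub[of "rev vs"] by simp
qed

text \<open>Vertex lists instead of edge sets allow an induction that strips the first vertex; the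
  price is that a path is listed once for each direction.\<close>

definition nc_lists :: "(point \<Rightarrow> nat) \<Rightarrow> point set \<Rightarrow> point list set" where
  "nc_lists f B = {vs. distinct vs \<and> set vs = B \<and> crossing_free f (path_edges vs)}"

lemma finite_nc_lists: "finite B \<Longrightarrow> finite (nc_lists f B)"
  by (rule finite_subset[OF _ finite_subset_distinct[of B]]) (auto simp: nc_lists_def)

text \<open>The second vertex of a non-crossing path is a cyclic neighbour of the first one: otherwise
  the first edge would separate the remaining vertices. In the proof, g is the position
  counted cyclically from the first vertex.\<close>

lemma card_second_vertex:
  assumes U: "finite U" "inj_on f U" "v \<in> U"
  obtains C where "finite C" "C \<subseteq> U - {v}" "card C \<le> 2"
    "\<And>u ws. v # u # ws \<in> nc_lists f U \<Longrightarrow> u \<in> C"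
proof -
  define M where "M = Suc (Max (f ` U))"
  have M: "f x < M" if "x \<in> U" for x using U that by (auto simp: M_def less_Suc_eq_le)
  \<comment> \<open>Cuts the cyclic order open at \<open>v\<close>: adding \<open>M\<close> moves
    the points before \<open>v\<close> behind all the others.\<close>
  define g where "g x = (if f v < f x then f x else f x + M)" for x
  define W where "W = U - {v}"
  have g_inj: "inj_on g W"
    unfolding inj_on_def
  proof (intro ballI impI)
    fix x y assume xy: "x \<in> W" "y \<in> W" "g x = g y"
    then have "f x = f y" using M[of x] M[of y] by (auto simp: g_def W_def split: if_splits)
    then show "x = y" using xy U by (auto simp: W_def inj_on_def)
  qed
  \<comment> \<open>\<open>C1\<close> and \<open>C2\<close> hold the cyclic successor and
    predecessor of \<open>v\<close>; they coincide if only one other point is left.\<close>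
  define C1 where "C1 = {u \<in> W. \<forall>x\<in>W. g u \<le> g x}"
  define C2 where "C2 = {u \<in> W. \<forall>x\<in>W. g x \<le> g u}"
  have finW: "finite W" using U by (simp add: W_def)
  have c1: "card C1 \<le> 1"
  proof -
    have "x = y" if "x \<in> C1" "y \<in> C1" for x y
    proof -
      have "x \<in> W" "y \<in> W" "g x \<le> g y" "g y \<le> g x" using that unfolding C1_def by simp_all
      then show ?thesis using inj_onD[OF g_inj, of x y] by simp
    qed
    moreover have "finite C1" using finW by (simp add: C1_def)
    ultimately show ?thesis by (simp only: card_le_Suc0_iff_eq One_nat_def) blast
  qed
  have c2: "card C2 \<le> 1"
  proof -
    have "x = y" if "x \<in> C2" "y \<in> C2" for x y
    proof -
      have "x \<in> W" "y \<in> W" "g x \<le> g y" "g y \<le> g x" using that unfolding C2_def by simp_all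
      then show ?thesis using inj_onD[OF g_inj, of x y] by simp
    qed
    moreover have "finite C2" using finW by (simp add: C2_def)
    ultimately show ?thesis by (simp only: card_le_Suc0_iff_eq One_nat_def) blast
  qed
  show thesis
  proof
    show "finite (C1 \<union> C2)" "C1 \<union> C2 \<subseteq> U - {v}" using finW by (auto simp: C1_def C2_def W_def)
    show "card (C1 \<union> C2) \<le> 2" using c1 c2 card_Un_le[of C1 C2] by simp
  next
    fix u ws assume vs: "v # u # ws \<in> nc_lists f U"
    then have W: "W = insert u (set ws)" and uv: "u \<noteq> v" "v \<notin> set ws" "u \<notin> set ws"
      by (auto simp: nc_lists_def W_def)
    have nc: "crossing_free f (path_edges (v # u # ws))" using vs by (simp add: nc_lists_def)
    show "u \<in> C1 \<union> C2"
    proof (rule ccontr)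
      assume "u \<notin> C1 \<union> C2"
      \<comment> \<open>Being neither nearest nor farthest, \<open>u\<close> has vertices of the
        remaining path on both sides, and some edge of that path must change sides.\<close>
      then obtain x y where "x \<in> set ws" "y \<in> set ws" "g x < g u" "\<not> g y < g u"
        using W by (auto simp: C1_def C2_def not_le)
      then obtain i where i: "Suc i < length ws" "(g (ws ! i) < g u) \<noteq> (g (ws ! Suc i) < g u)"
        using list_consecutive_change[of x ws y "\<lambda>z. g z < g u"] by blast
      define p q where "p = (if g (ws ! i) < g u then ws ! i else ws ! Suc i)"
        and "q = (if g (ws ! i) < g u then ws ! Suc i else ws ! i)"
      have pq: "g p < g u" "\<not> g q < g u" "p \<in> set ws" "q \<in> set ws" "{p, q} = {ws ! i, ws ! Suc i}"
        using i by (auto simp: p_def q_def)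
      have "{p, q} \<in> path_edges (v # u # ws)"
        unfolding path_edges_def pq(5) using i(1) by (intro CollectI exI[of _ "Suc (Suc i)"]) simp
      then have e1: "{p, q} \<in> path_edges (v # u # ws)" "{q, p} \<in> path_edges (v # u # ws)"
        by (simp_all add: insert_commute)
      have "{v, u} \<in> path_edges (v # u # ws)"
        unfolding path_edges_def by (intro CollectI exI[of _ 0]) simp
      then have e2: "{v, u} \<in> path_edges (v # u # ws)" "{u, v} \<in> path_edges (v # u # ws)"
        by (simp_all add: insert_commute)
      have inU: "u \<in> U" "p \<in> U" "q \<in> U" using W W_def pq by auto
      have "g q \<noteq> g u" using g_inj W pq uv by (auto simp: inj_on_def)
      then have gq: "g u < g q" using pq by simp
      have ne: "f u \<noteq> f v" "f p \<noteq> f v" "f q \<noteq> f v"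
        using U inU uv pq by (auto simp: inj_on_def)
      have lt: "f u < M" "f p < M" "f q < M" "f v < M" using M inU U by auto
      \<comment> \<open>The cyclic order v, p, u, q read in the linear order of \<open>f\<close>;
        the four cases are its rotations.\<close>
      have "(f v < f p \<and> f p < f u \<and> (f u < f q \<or> f q < f v)) \<or>
            (f u < f q \<and> f q < f v \<and> (f v < f p \<or> f p < f u))"
        using gq pq(1) ne lt by (auto simp: g_def split: if_splits)
      then show False using nc e1 e2 unfolding crossing_free_def by blast
    qed
  qed
qed

text \<open>After \<open>v\<close> is removed the rest is again such a list on fewer points,
  starting at one of at most two candidates. The last step has a single candidate, hence the
  exponent; truncated subtraction makes it 0 for a single point.\<close>

lemma card_nc_lists_from:
  assumes "finite U" "inj_on f U" "v \<in> U"
  shows "card {vs \<in> nc_lists f U. hd vs = v} \<le> 2 ^ (card U - 2)"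
  using assms
proof (induction "card U" arbitrary: U v rule: less_induct)
  case less
  let ?D = "\<lambda>U v. {vs \<in> nc_lists f U. hd vs = v}"
  show ?case
  proof (cases "card U = 1")
    case True
    then have "U = {v}" using less.prems by (auto simp: card_1_singleton_iff)
    then have "?D U v \<subseteq> {[v]}"
      by (auto simp: nc_lists_def) (metis card_1_singleton_iff distinct_card distinct_length_2_or_more
        empty_set insert_not_empty length_0_conv length_Suc_conv list.sel(1) One_nat_def card.empty card_insert_if finite.emptyI)
    then have "card (?D U v) \<le> card {[v]}" by (intro card_mono) auto
    then show ?thesis using True by simp
  next
    case False
    have cpos: "card U > 0" using less.prems by (auto simp: card_gt_0_iff)
    obtain C where C: "finite C" "C \<subseteq> U - {v}" "card C \<le> 2"
      "\<And>u ws. v # u # ws \<in> nc_lists f U \<Longrightarrow> u \<in> C"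
      using card_second_vertex[OF less.prems] by metis
    have cW: "card (U - {v}) = card U - 1" using less.prems by simp
    have sub: "?D U v \<subseteq> (\<Union>u\<in>C. Cons v ` ?D (U - {v}) u)"
    proof
      fix vs assume vs: "vs \<in> ?D U v"
      then have dvs: "distinct vs" "set vs = U" "hd vs = v" "crossing_free f (path_edges vs)"
        by (auto simp: nc_lists_def)
      have "length vs = card U" using dvs distinct_card by metis
      then have "length vs \<ge> 2" using False cpos by simp
      then obtain u ws where vuw: "vs = v # u # ws" using dvs(3)
        by (metis Suc_le_length_iff list.sel(1) numeral_2_eq_2)
      have "u \<in> C" using C(4) vs vuw by auto
      moreover have "u # ws \<in> ?D (U - {v}) u"
        using dvs crossing_free_mono[OF dvs(4)] path_edges_Cons[of "u # ws" v]
        unfolding nc_lists_def vuw by auto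
      ultimately show "vs \<in> (\<Union>u\<in>C. Cons v ` ?D (U - {v}) u)" using vuw by blast
    qed
    have fin: "finite (?D (U - {v}) u)" for u using less.prems finite_nc_lists by simp
    have "card (?D U v) \<le> card (\<Union>u\<in>C. Cons v ` ?D (U - {v}) u)"
      using sub fin C by (intro card_mono) auto
    also have "\<dots> \<le> (\<Sum>u\<in>C. card (Cons v ` ?D (U - {v}) u))" using C by (intro card_UN_le)
    also have "\<dots> \<le> (\<Sum>u\<in>C. card (?D (U - {v}) u))" using fin by (intro sum_mono card_image_le)
    also have "\<dots> \<le> (\<Sum>u\<in>C. 2 ^ (card U - 3))"
    proof (rule sum_mono)
      fix u assume "u \<in> C"
      then have "u \<in> U - {v}" using C by auto
      then show "card (?D (U - {v}) u) \<le> 2 ^ (card U - 3)"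
        using less.hyps[of "U - {v}" u] less.prems cW cpos inj_on_subset[of f U "U - {v}"]
        by (auto simp: numeral_3_eq_3)
    qed
    also have "\<dots> = card C * 2 ^ (card U - 3)" by simp
    \<comment> \<open>With two points both exponents are 0, so the bound 2 on \<open>card C\<close>
      would be too weak; there only one candidate exists.\<close>
    also have "\<dots> \<le> 2 ^ (card U - 2)"
    proof (cases "card U = 2")
      case True
      then have "card C \<le> 1" using card_mono[OF _ C(2)] less.prems cW by simp
      then show ?thesis using True by simp
    next
      case 2: False
      then have "card U - 2 = Suc (card U - 3)" using False cpos by simp
      then show ?thesis using C(3) by simp
    qed
    finally show ?thesis .
  qed
qed

text \<open>Every edge set arises from at least two lists, a list and its reversal. The factor 8
  combines this 2 with the 4 from the exponent \<open>card B - 2\<close> and avoids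
  division.\<close>

lemma card_nc_paths:
  assumes B: "finite B" "inj_on f B" "card B \<ge> 2"
  shows "finite (path_edges ` nc_lists f B)"
    and "8 * card (path_edges ` nc_lists f B) \<le> card B * 2 ^ card B"
proof -
  let ?L = "nc_lists f B" and ?P = "path_edges ` nc_lists f B"
  have fin: "finite ?L" using B finite_nc_lists by simp
  then show finP: "finite ?P" by simp
  have two: "2 \<le> card {vs \<in> ?L. path_edges vs = F}" if "F \<in> ?P" for F
  proof -
    from that obtain vs where vs: "vs \<in> ?L" "F = path_edges vs" by blast
    have len: "length vs \<ge> 2" using vs B by (auto simp: nc_lists_def dest: distinct_card)
    then obtain a ws where aws: "vs = a # ws" "ws \<noteq> []" by (cases vs; cases "tl vs") auto
    have "a \<notin> set ws" using vs(1) aws(1) by (simp add: nc_lists_def)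
    then have "last ws \<noteq> a" using aws(2) last_in_set by metis
    then have "hd (rev vs) \<noteq> hd vs" using aws by (simp add: hd_rev)
    then have "rev vs \<noteq> vs" by metis
    then have "card {vs, rev vs} = 2" by simp
    moreover have "{vs, rev vs} \<subseteq> {vs \<in> ?L. path_edges vs = F}"
      using vs by (auto simp: nc_lists_def path_edges_rev)
    ultimately show ?thesis using card_mono[of "{vs \<in> ?L. path_edges vs = F}" "{vs, rev vs}"] fin by auto
  qed
  have "2 * card ?P = (\<Sum>F\<in>?P. 2)" by simp
  also have "\<dots> \<le> (\<Sum>F\<in>?P. card {vs \<in> ?L. path_edges vs = F})" by (intro sum_mono two)
  also have "\<dots> = card ?L" using sum.image_gen[OF fin, of "\<lambda>_. 1::nat" path_edges] by simp
  also have "\<dots> \<le> card (\<Union>v\<in>B. {vs \<in> ?L. hd vs = v})"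
  proof (rule card_mono)
    show "?L \<subseteq> (\<Union>v\<in>B. {vs \<in> ?L. hd vs = v})"
    proof
      fix vs assume vs: "vs \<in> ?L"
      then have "vs \<noteq> []" using B(3) by (auto simp: nc_lists_def)
      then have "hd vs \<in> B" using vs hd_in_set[of vs] by (simp add: nc_lists_def)
      then show "vs \<in> (\<Union>v\<in>B. {vs \<in> ?L. hd vs = v})" using vs by blast
    qed
  qed (use fin B in auto)
  also have "\<dots> \<le> (\<Sum>v\<in>B. card {vs \<in> ?L. hd vs = v})" using B by (intro card_UN_le)
  also have "\<dots> \<le> (\<Sum>v\<in>B. 2 ^ (card B - 2))" using B by (intro sum_mono card_nc_lists_from)
  finally have "2 * card ?P \<le> card B * 2 ^ (card B - 2)" by simp
  moreover obtain m where "card B = m + 2" using B(3) by (metis add.commute le_Suc_ex)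
  ultimately show "8 * card ?P \<le> card B * 2 ^ card B" by simp
qed

section \<open>Non-crossing partitions\<close>

definition nc_partition :: "nat set \<Rightarrow> nat set set \<Rightarrow> bool" where
  "nc_partition S P \<longleftrightarrow> \<Union>P = S \<and> {} \<notin> P \<and> (\<forall>A\<in>P. \<forall>B\<in>P. A \<noteq> B \<longrightarrow> A \<inter> B = {} \<and>
     (\<forall>a\<in>A. \<forall>b\<in>B. \<forall>c\<in>A. \<forall>d\<in>B. \<not> (a < b \<and> b < c \<and> c < d)))"

lemma nc_partition_disjoint:
  "nc_partition S P \<Longrightarrow> A \<in> P \<Longrightarrow> B \<in> P \<Longrightarrow> x \<in> A \<Longrightarrow> x \<in> B \<Longrightarrow> A = B"
  unfolding nc_partition_def by blast

lemma nc_partition_noncrossing: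
  assumes "nc_partition S P" "A \<in> P" "B \<in> P" "A \<noteq> B"
    and "a \<in> A" "b \<in> B" "c \<in> A" "d \<in> B" "a < b" "b < c" "c < d"
  shows False
  using assms unfolding nc_partition_def by metis

lemma nc_partition_block:
  assumes "finite S" "nc_partition S P" "A \<in> P"
  shows "A \<subseteq> S" "finite A" "A \<noteq> {}"
proof -
  show "A \<subseteq> S" "A \<noteq> {}" using assms(2,3) unfolding nc_partition_def by blast+
  then show "finite A" using assms(1) finite_subset by blast
qed

text \<open>A foreign point x inside the range of \<open>B\<close> belongs to a block
  \<open>A\<close> that starts earlier, and then Min A < Min B < x < Max B alternates between the
  two blocks.\<close>

lemma nc_partition_last_block:
  assumes S: "finite S" and P: "nc_partition S P" and B: "B \<in> P"
    and last: "\<And>A. A \<in> P \<Longrightarrow> Min A \<le> Min B"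
  shows "{x \<in> S. Min B \<le> x \<and> x \<le> Max B} = B"
proof (intro set_eqI iffI)
  note block = nc_partition_block[OF S P]
  fix x
  show "x \<in> {x \<in> S. Min B \<le> x \<and> x \<le> Max B}" if "x \<in> B" using that block[OF B] by auto
  show "x \<in> B" if x: "x \<in> {x \<in> S. Min B \<le> x \<and> x \<le> Max B}"
  proof (rule ccontr)
    assume xB: "x \<notin> B"
    have "x \<in> \<Union>P" using x P by (simp add: nc_partition_def)
    then obtain A where A: "A \<in> P" "x \<in> A" by blast
    have AB: "A \<noteq> B" using A(2) xB by blast
    have mins: "Min A \<in> A" "Min B \<in> B" "Max B \<in> B" using block[OF A(1)] block[OF B] by simp_all
    have "Min A \<noteq> Min B" using nc_partition_disjoint[OF P A(1) B] mins AB by metis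
    then have "Min A < Min B" using last[OF A(1)] by simp
    moreover have "x \<noteq> Min B" "x \<noteq> Max B" using mins xB by blast+
    then have "Min B < x" "x < Max B" using x by simp_all
    ultimately show False
      using nc_partition_noncrossing[OF P A(1) B AB mins(1,2) A(2) mins(3)] by blast
  qed
qed

lemma nc_partition_remove:
  assumes "nc_partition S P" "B \<in> P"
  shows "nc_partition (S - B) (P - {B})"
  unfolding nc_partition_def
proof (intro conjI)
  show "\<Union>(P - {B}) = S - B"
    using assms(1) nc_partition_disjoint[OF assms(1) _ assms(2)] by (auto simp: nc_partition_def)
  show "{} \<notin> P - {B}" using assms(1) by (simp add: nc_partition_def)
  have all: "\<forall>A\<in>P. \<forall>B\<in>P. A \<noteq> B \<longrightarrow> A \<inter> B = {} \<and>
     (\<forall>a\<in>A. \<forall>b\<in>B. \<forall>c\<in>A. \<forall>d\<in>B. \<not> (a < b \<and> b < c \<and> c < d))"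
    using assms(1) unfolding nc_partition_def by (elim conjE)
  show "\<forall>A\<in>P - {B}. \<forall>C\<in>P - {B}. A \<noteq> C \<longrightarrow> A \<inter> C = {} \<and>
     (\<forall>a\<in>A. \<forall>b\<in>C. \<forall>c\<in>A. \<forall>d\<in>C. \<not> (a < b \<and> b < c \<and> c < d))"
    by (intro ballI) (rule bspec[OF bspec[OF all]]; erule DiffD1)
qed

lemma nc_partition_Min_inj:
  assumes "finite S" "nc_partition S P" shows "inj_on Min P"
proof (rule inj_onI)
  fix A B assume AB: "A \<in> P" "B \<in> P" "Min A = Min B"
  have "Min A \<in> A" "Min B \<in> B"
    using nc_partition_block[OF assms AB(1)] nc_partition_block[OF assms AB(2)] by simp_all
  then show "A = B" using nc_partition_disjoint[OF assms(2) AB(1,2)] AB(3) by metis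
qed

text \<open>The block with the largest minimum is an interval of the ground set, so it is determined by
  its minimum and its size; remove it and repeat.\<close>

lemma nc_partition_determined:
  assumes "finite S" "nc_partition S P" "nc_partition S Q"
    and "(\<lambda>B. (Min B, card B)) ` P = (\<lambda>B. (Min B, card B)) ` Q"
  shows "P = Q"
  using assms
proof (induction "card S" arbitrary: S P Q rule: less_induct)
  case less
  let ?\<phi> = "\<lambda>B::nat set. (Min B, card B)"
  note S = less.prems(1) and P = less.prems(2) and Q = less.prems(3) and eq = less.prems(4)
  show ?case
  proof (cases "P = {}")
    case True
    then show ?thesis using eq by simp
  next
    case False
    have finP: "finite P" using P S by (intro finite_UnionD) (simp add: nc_partition_def)
    have "Max (Min ` P) \<in> Min ` P" using False finP by simp
    then obtain B where B: "B \<in> P" "Min B = Max (Min ` P)" by auto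
    have lastP: "Min A \<le> Min B" if "A \<in> P" for A using that B finP by simp
    obtain B' where B': "B' \<in> Q" "Min B' = Min B" "card B' = card B" using eq B(1) by (force simp: image_iff)
    have lastQ: "Min A \<le> Min B'" if A: "A \<in> Q" for A
    proof -
      have "?\<phi> A \<in> ?\<phi> ` P" using A eq by auto
      then show ?thesis using lastP B'(2) by auto
    qed
    have iB: "{x \<in> S. Min B \<le> x \<and> x \<le> Max B} = B" using nc_partition_last_block[OF S P B(1) lastP] .
    have iB': "{x \<in> S. Min B \<le> x \<and> x \<le> Max B'} = B'"
      using nc_partition_last_block[OF S Q B'(1) lastQ] B'(2) by simp
    have finB: "finite B" "finite B'" using iB iB' S by (metis finite_Collect_conjI finite_subset mem_Collect_eq subsetI)+
    \<comment> \<open>Both are intervals of \<open>S\<close> with the same left end, hence nested,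
      and their cardinalities agree.\<close>
    have "B \<subseteq> B' \<or> B' \<subseteq> B"
      by (subst (1 2) iB[symmetric], subst (1 2) iB'[symmetric]) auto
    then have BB': "B = B'" using finB B'(3) card_subset_eq by metis
    have "B \<noteq> {}" "B \<subseteq> S" using P B by (auto simp: nc_partition_def)
    then have "card (S - B) < card S" using S by (intro psubset_card_mono) auto
    moreover have "?\<phi> ` (P - {B}) = ?\<phi> ` (Q - {B})"
    proof -
      \<comment> \<open>Injectivity lets the image commute with removing the block, so the equality
        of images passes to the smaller partitions.\<close>
      have "inj_on ?\<phi> P" "inj_on ?\<phi> Q"
        using nc_partition_Min_inj[OF S P] nc_partition_Min_inj[OF S Q] by (auto simp: inj_on_def)
      then show ?thesis using B(1) B'(1) BB' eq by (simp add: inj_on_image_set_diff[where C=P] inj_on_image_set_diff[where C=Q])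
    qed
    ultimately have "P - {B} = Q - {B}"
      using less.hyps[of "S - B" "P - {B}" "Q - {B}"] S nc_partition_remove[OF P B(1)]
        nc_partition_remove[OF Q B'(1)] BB' by simp
    then show ?thesis using B(1) B'(1) BB' by blast
  qed
qed

section \<open>Components of non-crossing graphs\<close>

lemma rtrancl_change:
  assumes "(x, y) \<in> r\<^sup>*" "P x" "\<not> P y"
  obtains u v where "(x, u) \<in> r\<^sup>*" "(u, v) \<in> r" "P u" "\<not> P v"
  using assms by (induction arbitrary: thesis rule: rtrancl_induct) blast+

lemma adj_sym: "(adj E)\<inverse> = adj E"
  by (auto simp: adj_def insert_commute)

lemma component_sym: "w \<in> component E v \<longleftrightarrow> v \<in> component E w"
  unfolding component_def mem_Collect_eq by (metis adj_sym rtrancl_converse converse_iff)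

lemma component_self: "v \<in> component E v"
  by (simp add: component_def)

lemma component_eq: "w \<in> component E v \<Longrightarrow> component E w = component E v"
proof -
  assume w: "w \<in> component E v"
  then have "v \<in> component E w" using component_sym by blast
  with w show ?thesis unfolding component_def by (auto intro: rtrancl_trans)
qed

lemma component_disjoint: "component E v \<noteq> component E w \<Longrightarrow> component E v \<inter> component E w = {}"
  using component_eq by blast

lemma component_step: "w \<in> component E v \<Longrightarrow> {w, u} \<in> E \<Longrightarrow> u \<in> component E v"
  unfolding component_def adj_def by (auto intro: rtrancl_into_rtrancl)

lemma component_subset:
  assumes "straight_graph S E" "v \<in> S"
  shows "component E v \<subseteq> S"
proof
  fix w assume "w \<in> component E v"
  then have "(v, w) \<in> (adj E)\<^sup>*" by (simp add: component_def)
  then show "w \<in> S"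
  proof (induction rule: rtrancl_induct)
    case (step y z)
    then have "{y, z} \<in> E" by (simp add: adj_def)
    then obtain a b where "a \<in> S" "b \<in> S" "{y, z} = {a, b}"
      using assms(1) unfolding straight_graph_def by meson
    then show ?case by (auto simp: doubleton_eq_iff)
  qed (use assms in simp)
qed

lemma component_edge_change:
  assumes "x \<in> component E v" "y \<in> component E v" "P x" "\<not> P y"
  obtains u w where "u \<in> component E v" "w \<in> component E v" "{u, w} \<in> E" "P u" "\<not> P w"
proof -
  have iff: "z \<in> component E v \<longleftrightarrow> (x, z) \<in> (adj E)\<^sup>*" for z
    unfolding component_eq[OF assms(1), symmetric] by (simp add: component_def)
  have "(x, y) \<in> (adj E)\<^sup>*" using assms(2) iff by blast
  then obtain u w where uw: "(x, u) \<in> (adj E)\<^sup>*" "(u, w) \<in> adj E" "P u" "\<not> P w"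
    using rtrancl_change[of x y "adj E" P] assms by metis
  have "u \<in> component E v" using uw(1) iff by blast
  moreover have "{u, w} \<in> E" using uw by (simp add: adj_def)
  ultimately show thesis using that component_step uw by blast
qed

text \<open>Alternating vertices have to be turned into alternating edges. The first component has
  points inside and outside the range from b to d, so an edge pq of it leaves that range. Exactly
  one of b and d then lies between p and q, so an edge of the second component leaves the range
  between p and q.\<close>

lemma components_noncrossing:
  assumes inj: "inj_on f S" and graph: "straight_graph S E" and nc: "crossing_free f E"
    and vw: "v \<in> S" "w \<in> S" "component E v \<noteq> component E w"
    and ac: "a \<in> component E v" "c \<in> component E v" and bd: "b \<in> component E w" "d \<in> component E w"
    and lt: "f a < f b" "f b < f c" "f c < f d"
  shows False
proof -
  have disj: "component E v \<inter> component E w = {}" using component_disjoint vw by blast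
  have ne: "f x \<noteq> f y" if "x \<in> component E v" "y \<in> component E w" for x y
  proof -
    have "x \<noteq> y" "x \<in> S" "y \<in> S" using that disj component_subset[OF graph] vw by blast+
    then show ?thesis using inj inj_on_def by metis
  qed
  let ?P = "\<lambda>x. f b < f x \<and> f x < f d"
  have "?P c" "\<not> ?P a" using lt by auto
  then obtain p q where pq: "p \<in> component E v" "q \<in> component E v" "{p, q} \<in> E" "?P p" "\<not> ?P q"
    using component_edge_change[OF ac(2,1), of ?P] by metis
  let ?R = "\<lambda>x. min (f p) (f q) < f x \<and> f x < max (f p) (f q)"
  have "f q \<noteq> f b" "f q \<noteq> f d" using ne pq bd by auto
  then have R: "?R b \<noteq> ?R d" using pq(4,5) by (auto simp: min_def max_def)
  obtain r s where rs: "r \<in> component E w" "s \<in> component E w" "{r, s} \<in> E" "?R r" "\<not> ?R s"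
  proof (cases "?R b")
    case True
    then show thesis using component_edge_change[OF bd, of ?R] R that by metis
  next
    case False
    then show thesis using component_edge_change[OF bd(2,1), of ?R] R that by metis
  qed
  have nes: "f s \<noteq> f p" "f s \<noteq> f q" using ne[OF pq(1) rs(2)] ne[OF pq(2) rs(2)] by auto
  have E: "{p, q} \<in> E" "{q, p} \<in> E" "{r, s} \<in> E" "{s, r} \<in> E" using pq rs by (simp_all add: insert_commute)
  \<comment> \<open>As \<open>s\<close> differs from \<open>p\<close> and \<open>q\<close>, it lies
    strictly outside their range; the cases are its side and the order of \<open>p\<close> and
    \<open>q\<close>.\<close>
  have "(f p < f r \<and> f r < f q \<and> f q < f s) \<or> (f q < f r \<and> f r < f p \<and> f p < f s) \<or>
        (f s < f p \<and> f p < f r \<and> f r < f q) \<or> (f s < f q \<and> f q < f r \<and> f r < f p)"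
    using rs(4,5) nes by (auto simp: min_def max_def split: if_splits)
  then show False using nc E unfolding crossing_free_def by blast
qed

section \<open>Block sizes as a code for the components of a graph\<close>

definition size_code :: "(point \<Rightarrow> nat) \<Rightarrow> point set \<Rightarrow> point set set \<Rightarrow> point \<Rightarrow> nat" where
  "size_code f S E = (\<lambda>v\<in>S. if \<forall>u\<in>component E v. f v \<le> f u then card (component E v) else 0)"

definition graph_blocks :: "(point \<Rightarrow> nat) \<Rightarrow> point set \<Rightarrow> point set set \<Rightarrow> nat set set" where
  "graph_blocks f S E = (\<lambda>v. f ` component E v) ` S"

lemma nc_partition_graph_blocks:
  assumes inj: "inj_on f S" and graph: "straight_graph S E" and nc: "crossing_free f E"
  shows "nc_partition (f ` S) (graph_blocks f S E)"
proof -
  have sub: "component E v \<subseteq> S" if "v \<in> S" for v using component_subset[OF graph that] .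
  have U: "\<Union>(graph_blocks f S E) = f ` S"
    unfolding graph_blocks_def using sub component_self by blast
  have N: "{} \<notin> graph_blocks f S E" unfolding graph_blocks_def using component_self by blast
  have R: "A \<inter> B = {} \<and> (\<forall>a\<in>A. \<forall>b\<in>B. \<forall>c\<in>A. \<forall>d\<in>B. \<not> (a < b \<and> b < c \<and> c < d))"
    if AB: "A \<in> graph_blocks f S E" "B \<in> graph_blocks f S E" "A \<noteq> B" for A B
  proof -
    obtain v w where vw: "v \<in> S" "w \<in> S" "A = f ` component E v" "B = f ` component E w"
      using AB(1,2) by (auto simp: graph_blocks_def)
    then have ne: "component E v \<noteq> component E w" using AB(3) by auto
    have "A \<inter> B = f ` (component E v \<inter> component E w)"
      unfolding vw by (rule inj_on_image_Int[OF inj, symmetric]) (use sub vw in auto)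
    then have "A \<inter> B = {}" using component_disjoint[OF ne] by simp
    moreover have "\<not> (a < b \<and> b < c \<and> c < d)" if "a \<in> A" "b \<in> B" "c \<in> A" "d \<in> B" for a b c d
      using that components_noncrossing[OF inj graph nc vw(1,2) ne] unfolding vw by blast
    ultimately show ?thesis by blast
  qed
  show ?thesis unfolding nc_partition_def
    by (rule conjI[OF U conjI[OF N]], rule ballI, rule ballI, rule impI, rule R)
qed

lemma obtain_min:
  assumes "finite B" "B \<noteq> {}"
  obtains w where "w \<in> B" "\<And>u. u \<in> B \<Longrightarrow> (f w :: nat) \<le> f u"
  using ex_min_if_finite[of "f ` B"] assms
  by (metis arg_min_least arg_min_if_finite(1))

text \<open>A positive code value marks the first point of a component and gives its size, so equal
  codes yield components with the same first point and size. Exchanging the two graphs gives the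
  other inclusion.\<close>

lemma size_code_blocks:
  assumes fin: "finite S" and inj: "inj_on f S"
    and graph: "straight_graph S E" "straight_graph S E'"
    and eq: "size_code f S E = size_code f S E'"
  shows "(\<lambda>B. (Min B, card B)) ` graph_blocks f S E \<subseteq> (\<lambda>B. (Min B, card B)) ` graph_blocks f S E'"
proof
  fix z assume "z \<in> (\<lambda>B. (Min B, card B)) ` graph_blocks f S E"
  then obtain v where v: "v \<in> S" "z = (Min (f ` component E v), card (f ` component E v))"
    by (auto simp: graph_blocks_def)
  have sub: "component E v \<subseteq> S" using component_subset[OF graph(1) v(1)] .
  then have fc: "finite (component E v)" using fin finite_subset by blast
  obtain w where w: "w \<in> component E v" "\<And>u. u \<in> component E v \<Longrightarrow> f w \<le> f u"
    using obtain_min[OF fc, of f] component_self by (metis empty_iff)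
  have ceq: "component E w = component E v" using component_eq[OF w(1)] .
  have wS: "w \<in> S" using w(1) sub by blast
  have sub': "component E' w \<subseteq> S" using component_subset[OF graph(2) wS] .
  then have fc': "finite (component E' w)" using fin finite_subset by blast
  have code: "size_code f S E w = card (component E v)"
    using w(2) wS ceq by (simp add: size_code_def)
  then have code': "size_code f S E' w = card (component E v)" by (simp add: eq)
  \<comment> \<open>This rules out the default value 0 in the code of \<open>E'\<close>, so
    \<open>w\<close> comes first in its component there as well.\<close>
  have pos: "card (component E v) > 0" using fc w(1) by (auto simp: card_gt_0_iff)
  have min': "\<forall>u\<in>component E' w. f w \<le> f u"
    using code' pos wS by (auto simp: size_code_def split: if_splits)
  have card': "card (component E' w) = card (component E v)"
    using code' wS min' by (simp add: size_code_def)
  have "Min (f ` component E v) = f w" using fc w by (intro Min_eqI) auto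
  moreover have "Min (f ` component E' w) = f w"
    using fc' min' component_self by (intro Min_eqI) auto
  moreover have "card (f ` component E v) = card (f ` component E' w)"
    using card' inj_on_subset[OF inj sub] inj_on_subset[OF inj sub'] by (simp add: card_image)
  ultimately have "z = (Min (f ` component E' w), card (f ` component E' w))" using v(2) by simp
  then show "z \<in> (\<lambda>B. (Min B, card B)) ` graph_blocks f S E'"
    unfolding graph_blocks_def using wS by blast
qed

lemma size_code_determines_components:
  assumes fin: "finite S" and inj: "inj_on f S"
    and E: "straight_graph S E" "crossing_free f E" and E': "straight_graph S E'" "crossing_free f E'"
    and eq: "size_code f S E = size_code f S E'" and v: "v \<in> S"
  shows "component E v = component E' v"
proof -
  have P: "nc_partition (f ` S) (graph_blocks f S E)" and Q: "nc_partition (f ` S) (graph_blocks f S E')"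
    using nc_partition_graph_blocks inj E E' by auto
  have "graph_blocks f S E = graph_blocks f S E'"
    using nc_partition_determined[OF _ P Q] fin
      size_code_blocks[OF fin inj E(1) E'(1) eq] size_code_blocks[OF fin inj E'(1) E(1) eq[symmetric]]
    by blast
  then have "f ` component E v \<in> graph_blocks f S E'" "f ` component E' v \<in> graph_blocks f S E'"
    using v by (auto simp: graph_blocks_def)
  moreover have "f v \<in> f ` component E v" "f v \<in> f ` component E' v" using component_self by blast+
  ultimately have "f ` component E v = f ` component E' v"
    using nc_partition_disjoint[OF Q] by metis
  then show ?thesis
    using inj_on_image_eq_iff[OF inj] component_subset[OF E(1) v] component_subset[OF E'(1) v] by blast
qed

text \<open>The first points of the components are distinct representatives, so the nonzero values
  are sizes of disjoint subsets of \<open>S\<close>.\<close>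

lemma sum_size_code_le:
  assumes fin: "finite S" and inj: "inj_on f S" and graph: "straight_graph S E"
  shows "(\<Sum>v\<in>S. size_code f S E v) \<le> card S"
proof -
  let ?M = "{v \<in> S. \<forall>u\<in>component E v. f v \<le> f u}"
  have sub: "component E v \<subseteq> S" if "v \<in> S" for v using component_subset[OF graph that] .
  have disj: "component E v \<inter> component E w = {}" if vw: "v \<in> ?M" "w \<in> ?M" "v \<noteq> w" for v w
  proof (rule ccontr)
    assume "component E v \<inter> component E w \<noteq> {}"
    then have eq: "component E v = component E w" using component_disjoint by blast
    have "f v \<le> f w" "f w \<le> f v"
      using vw eq component_self[of w E] component_self[of v E] by auto
    then have "f v = f w" by simp
    then show False using inj_onD[OF inj, of v w] vw by simp
  qed
  have "(\<Sum>v\<in>S. size_code f S E v) = (\<Sum>v\<in>?M. card (component E v))"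
    unfolding size_code_def using fin by (simp add: sum.If_cases Int_def)
  also have "\<dots> = card (\<Union>v\<in>?M. component E v)"
  proof (rule card_UN_disjoint[symmetric])
    show "\<forall>v\<in>?M. finite (component E v)" using finite_subset[OF sub fin] by simp
    show "\<forall>v\<in>?M. \<forall>w\<in>?M. v \<noteq> w \<longrightarrow> component E v \<inter> component E w = {}"
      by (intro ballI impI) (rule disj)
  qed (use fin in simp)
  also have "\<dots> \<le> card S" using sub fin by (intro card_mono) auto
  finally show ?thesis .
qed

section \<open>Graphs that share one code\<close>

definition component_paths :: "(point \<Rightarrow> nat) \<Rightarrow> point set set \<Rightarrow> (point \<Rightarrow> nat) \<Rightarrow> point \<Rightarrow> point set set set" where
  "component_paths f E0 \<kappa> v = (if \<kappa> v = 0 then {{}} else path_edges ` nc_lists f (component E0 v))"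

text \<open>For k >= 2 this counts k starting points and at most two choices per step except the last
  one, divided by two for the orientation of the path; k = 0 occurs at the points that are not first
  in their block.\<close>

definition path_weight :: "nat \<Rightarrow> real" where
  "path_weight k = (if k = 0 then 1 else real k * 2 ^ k / 8)"

lemma ncpws_component:
  assumes E: "ncpws S E" and nc: "crossing_free f E" and v: "v \<in> S"
  shows "{e \<in> E. e \<subseteq> component E v} \<in> path_edges ` nc_lists f (component E v)"
    and "card (component E v) \<ge> 2"
proof -
  obtain vs where vs: "distinct vs" "length vs \<ge> 2" "set vs = component E v"
    "{e \<in> E. e \<subseteq> component E v} = path_edges vs"
    using E v unfolding ncpws_def component_is_path_def by blast
  have "crossing_free f (path_edges vs)"
    using crossing_free_mono[OF nc, of "path_edges vs"] vs(4) by blast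
  then show "{e \<in> E. e \<subseteq> component E v} \<in> path_edges ` nc_lists f (component E v)"
    unfolding vs(4) nc_lists_def using vs by blast
  show "card (component E v) \<ge> 2" using vs distinct_card[OF vs(1)] by simp
qed

lemma size_code_eq_0_or_ge_2:
  assumes "ncpws S E" "crossing_free f E" "v \<in> S"
  shows "size_code f S E v = 0 \<or> size_code f S E v = card (component E v) \<and> size_code f S E v \<ge> 2"
  using ncpws_component(2)[OF assms] assms(3) by (auto simp: size_code_def)

text \<open>Every edge stays inside one component, and that component has a first point. A graph can
  thus be recovered from its parts at the points with nonzero code.\<close>

lemma edges_eq_Union:
  assumes fin: "finite S" and graph: "straight_graph S E"
    and pos: "\<And>v. v \<in> S \<Longrightarrow> card (component E v) \<noteq> 0"
  shows "E = (\<Union>v\<in>{v \<in> S. size_code f S E v \<noteq> 0}. {e \<in> E. e \<subseteq> component E v})"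
proof
  show "E \<subseteq> (\<Union>v\<in>{v \<in> S. size_code f S E v \<noteq> 0}. {e \<in> E. e \<subseteq> component E v})"
  proof
    fix e assume e: "e \<in> E"
    then obtain a b where ab: "a \<in> S" "b \<in> S" "e = {a, b}"
      using graph unfolding straight_graph_def by meson
    have "b \<in> component E a" using e ab component_step[OF component_self, of a b E] by simp
    then have eC: "e \<subseteq> component E a" using ab component_self by blast
    have sub: "component E a \<subseteq> S" using component_subset[OF graph ab(1)] .
    obtain w where w: "w \<in> component E a" "\<And>u. u \<in> component E a \<Longrightarrow> f w \<le> f u"
      using obtain_min[of "component E a" f] finite_subset[OF sub fin] component_self by (metis empty_iff)
    have ceq: "component E w = component E a" using component_eq[OF w(1)] .
    have "w \<in> S" using w sub by blast
    moreover have "size_code f S E w \<noteq> 0"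
      using pos[OF \<open>w \<in> S\<close>] w(2) \<open>w \<in> S\<close> ceq by (simp add: size_code_def)
    ultimately show "e \<in> (\<Union>v\<in>{v \<in> S. size_code f S E v \<noteq> 0}. {e \<in> E. e \<subseteq> component E v})"
      using e eC ceq by blast
  qed
qed blast

text \<open>All graphs in \<open>N\<close> have the same components, so they differ only in the path
  chosen on each block, and these choices range over a product.\<close>

lemma card_size_code_fibre:
  assumes fin: "finite S" and inj: "inj_on f S"
    and N: "\<And>E. E \<in> N \<Longrightarrow> ncpws S E \<and> crossing_free f E \<and> size_code f S E = \<kappa>"
  shows "finite N \<and> real (card N) \<le> (\<Prod>v\<in>S. path_weight (\<kappa> v))"
proof (cases "N = {}")
  case True
  then show ?thesis by (auto intro!: prod_nonneg simp: path_weight_def)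
next
  case False
  then obtain E0 where E0: "E0 \<in> N" by blast
  \<comment> \<open>The components of the fixed graph \<open>E0\<close> serve for all of
    \<open>N\<close>. Points with code 0 contribute only the empty choice, which extends the product
    to all of \<open>S\<close>.\<close>
  let ?T = "component_paths f E0 \<kappa>"
  let ?F = "\<lambda>E. \<lambda>v\<in>S. if \<kappa> v = 0 then {} else {e \<in> E. e \<subseteq> component E v}"
  have graph: "straight_graph S E" if "E \<in> N" for E using N[OF that] by (simp add: ncpws_def)
  have comp: "component E v = component E0 v" if "E \<in> N" "v \<in> S" for E v
    using size_code_determines_components[OF fin inj graph _ graph _ _ that(2)] N that E0 by metis
  have into: "?F \<in> N \<rightarrow> Pi\<^sub>E S ?T"
  proof (rule Pi_I, rule PiE_I)
    fix E v assume E: "E \<in> N" and v: "v \<in> S"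
    show "?F E v \<in> ?T v"
      using ncpws_component(1)[of S E f v] N[OF E] v comp[OF E v] by (simp add: component_paths_def)
  qed simp
  have inj_F: "inj_on ?F N"
  proof (rule inj_onI)
    fix E E' assume E: "E \<in> N" "E' \<in> N" "?F E = ?F E'"
    have rec: "G = (\<Union>v\<in>{v \<in> S. \<kappa> v \<noteq> 0}. ?F G v)" if G: "G \<in> N" for G
    proof -
      have "card (component G v) \<noteq> 0" if "v \<in> S" for v
        using ncpws_component(2)[of S G f v] N[OF G] that by auto
      then have "G = (\<Union>v\<in>{v \<in> S. size_code f S G v \<noteq> 0}. {e \<in> G. e \<subseteq> component G v})"
        by (rule edges_eq_Union[OF fin graph[OF G]])
      moreover have "size_code f S G = \<kappa>" using N[OF G] by simp
      ultimately show ?thesis by auto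
    qed
    show "E = E'" using rec[OF E(1)] rec[OF E(2)] E(3) by simp
  qed
  have T: "finite (?T v) \<and> real (card (?T v)) \<le> path_weight (\<kappa> v)" if v: "v \<in> S" for v
  proof (cases "\<kappa> v = 0")
    case True
    then show ?thesis by (simp add: component_paths_def path_weight_def)
  next
    case False
    let ?B = "component E0 v"
    have k: "\<kappa> v = card ?B" "card ?B \<ge> 2"
      using size_code_eq_0_or_ge_2[of S E0 f v] N[OF E0] v False by auto
    have B: "finite ?B" "inj_on f ?B"
      using component_subset[OF graph[OF E0] v] fin inj finite_subset inj_on_subset by blast+
    have "8 * card (?T v) \<le> card ?B * 2 ^ card ?B"
      using card_nc_paths(2)[OF B k(2)] False by (simp add: component_paths_def)
    then have "real (8 * card (?T v)) \<le> real (card ?B * 2 ^ card ?B)" by (rule of_nat_mono)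
    then show ?thesis using card_nc_paths(1)[OF B k(2)] False k
      by (simp add: component_paths_def path_weight_def)
  qed
  have finP: "finite (Pi\<^sub>E S ?T)" using T fin by (intro finite_PiE) auto
  have img: "?F ` N \<subseteq> Pi\<^sub>E S ?T" using into by blast
  have finN: "finite N" using finite_imageD[OF finite_subset[OF img finP] inj_F] .
  have "card N \<le> card (Pi\<^sub>E S ?T)" using card_inj_on_le[OF inj_F img finP] .
  then have "real (card N) \<le> (\<Prod>v\<in>S. real (card (?T v)))" using fin by (simp add: card_PiE flip: of_nat_prod)
  also have "\<dots> \<le> (\<Prod>v\<in>S. path_weight (\<kappa> v))" using T by (intro prod_mono) auto
  finally show ?thesis using finN by simp
qed

section \<open>The bound\<close>

text \<open>The differentiated geometric series times x, without its term for k = 1; its partial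
  sums stay below the limit because all terms are nonnegative.\<close>

lemma sum_arith_geometric_le:
  fixes x :: real
  assumes "0 \<le> x" "x < 1"
  shows "(\<Sum>k\<in>{2..n}. real k * x ^ k) \<le> x / (1 - x)\<^sup>2 - x"
proof -
  have "(\<lambda>n. real (Suc n) * x ^ n) sums (1 / (1 - x)\<^sup>2)"
    using geometric_deriv_sums[of x] assms by simp
  then have "summable (\<lambda>n. real (Suc n) * x ^ n)" "(\<Sum>n. real (Suc n) * x ^ n) = 1 / (1 - x)\<^sup>2"
    by (simp_all only: sums_iff)
  moreover have "0 \<le> real (Suc k) * x ^ k" for k using assms by (intro mult_nonneg_nonneg) auto
  ultimately have "(\<Sum>k<Suc n. real (Suc k) * x ^ k) \<le> 1 / (1 - x)\<^sup>2"
    using sum_le_suminf[of "\<lambda>n. real (Suc n) * x ^ n" "{..<Suc n}"] by (simp del: of_nat_Suc)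
  then have "x * (\<Sum>k<Suc n. real (Suc k) * x ^ k) \<le> x * (1 / (1 - x)\<^sup>2)"
    using assms by (intro mult_left_mono)
  also have "x * (\<Sum>k<Suc n. real (Suc k) * x ^ k) = (\<Sum>k<Suc n. real (Suc k) * x ^ Suc k)"
    unfolding sum_distrib_left by (intro sum.cong) simp_all
  also have "\<dots> = x + (\<Sum>k<n. real (Suc (Suc k)) * x ^ Suc (Suc k))"
    by (subst sum.lessThan_Suc_shift) simp
  also have "(\<Sum>k<n. real (Suc (Suc k)) * x ^ Suc (Suc k)) = (\<Sum>k\<in>{2..<n+2}. real k * x ^ k)"
    by (rule sum.reindex_bij_witness[of _ "\<lambda>k. k - 2" "\<lambda>k. k + 2"]) auto
  finally have "(\<Sum>k\<in>{2..<n+2}. real k * x ^ k) \<le> x / (1 - x)\<^sup>2 - x" by simp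
  moreover have "(\<Sum>k\<in>{2..n}. real k * x ^ k) \<le> (\<Sum>k\<in>{2..<n+2}. real k * x ^ k)"
    using assms by (intro sum_mono2) auto
  ultimately show ?thesis by simp
qed

text \<open>A coefficient bound in the style of generating functions: summing over all codes with
  weight y^k at each point gives a power, and the total at most n costs a division by y^n.\<close>

lemma card_ncpws_le:
  fixes y :: real
  assumes fin: "finite S" and S: "convex_position S" and y: "0 < y" "2 * y < 1"
  shows "real (card {E. ncpws S E}) \<le> ((1 + (2 * y / (1 - 2 * y)\<^sup>2 - 2 * y) / 8) / y) ^ card S"
proof -
  let ?n = "card S" and ?N = "{E. ncpws S E}"
  obtain f :: "point \<Rightarrow> nat" where inj: "inj_on f S"
    and cross: "\<And>w x y z. w \<in> S \<Longrightarrow> x \<in> S \<Longrightarrow> y \<in> S \<Longrightarrow> z \<in> S \<Longrightarrow> f w < f x \<Longrightarrow> f x < f y \<Longrightarrow> f y < f z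
      \<Longrightarrow> convex hull {w, y} \<inter> convex hull {x, z} \<noteq> {}"
    using convex_position_crossing_key[OF fin S] by metis
  have graph: "straight_graph S E" if "ncpws S E" for E using that by (simp add: ncpws_def)
  have nc: "crossing_free f E" if E: "ncpws S E" for E
    unfolding crossing_free_def
  proof (intro allI impI notI)
    fix a b c d assume e: "{a, c} \<in> E" "{b, d} \<in> E" and lt: "f a < f b \<and> f b < f c \<and> f c < f d"
    have inS: "p \<in> S \<and> q \<in> S" if "{p, q} \<in> E" for p q
    proof -
      obtain r s where "r \<in> S" "s \<in> S" "{p, q} = {r, s}"
        using graph[OF E] \<open>{p, q} \<in> E\<close> unfolding straight_graph_def by meson
      then show ?thesis by (auto simp: doubleton_eq_iff)
    qed
    \<comment> \<open>Edges may meet in common endpoints only; without such endpoints the segments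
      are disjoint.\<close>
    have "{a, c} \<inter> {b, d} = {}" using lt by auto
    then have "edge_seg {a, c} \<inter> edge_seg {b, d} = {}"
      using E e unfolding ncpws_def non_crossing_def by (metis insert_not_empty inf.idem subset_empty)
    then show False using cross[of a b c d] inS[OF e(1)] inS[OF e(2)] lt by (simp add: edge_seg_def)
  qed
  \<comment> \<open>The value 1 is left out because isolated points are excluded; the upper limit
    keeps the set finite.\<close>
  define A where "A = insert 0 {2..?n}"
  define K where "K = {\<kappa> \<in> Pi\<^sub>E S (\<lambda>_. A). (\<Sum>v\<in>S. \<kappa> v) \<le> ?n}"
  define fib where "fib \<kappa> = {E \<in> ?N. size_code f S E = \<kappa>}" for \<kappa>
  have finP: "finite (Pi\<^sub>E S (\<lambda>_. A))" using fin by (intro finite_PiE) (simp_all add: A_def)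
  have finK: "finite K" unfolding K_def by (rule finite_subset[OF _ finP]) blast
  have fib: "finite (fib \<kappa>) \<and> real (card (fib \<kappa>)) \<le> (\<Prod>v\<in>S. path_weight (\<kappa> v))" for \<kappa>
    by (rule card_size_code_fibre[OF fin inj]) (auto simp: fib_def nc)
  have code: "size_code f S E \<in> K" if E: "ncpws S E" for E
  proof -
    have "size_code f S E v \<in> A" if v: "v \<in> S" for v
      using size_code_eq_0_or_ge_2[OF E nc[OF E] v] card_mono[OF fin component_subset[OF graph[OF E] v]]
      by (auto simp: A_def)
    \<comment> \<open>Restricting the code to \<open>S\<close> makes it a member of the finite
      function space \<open>Pi\<^sub>E S (\<lambda>_. A)\<close>.\<close>
    moreover have "size_code f S E \<in> extensional S" by (simp add: size_code_def)
    ultimately show ?thesis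
      using sum_size_code_le[OF fin inj graph[OF E]] by (auto simp: K_def PiE_def)
  qed
  have "card ?N \<le> card (\<Union>\<kappa>\<in>K. fib \<kappa>)"
    using code finK fib by (intro card_mono) (auto simp: fib_def)
  also have "\<dots> \<le> (\<Sum>\<kappa>\<in>K. card (fib \<kappa>))" by (rule card_UN_le[OF finK])
  finally have "real (card ?N) \<le> (\<Sum>\<kappa>\<in>K. real (card (fib \<kappa>)))" by (metis of_nat_le_iff of_nat_sum)
  also have "\<dots> \<le> (\<Sum>\<kappa>\<in>K. \<Prod>v\<in>S. path_weight (\<kappa> v))" using fib by (intro sum_mono) auto
  \<comment> \<open>Since y < 1 and the total is at most n, the inserted factor is at least 1. The
    division by y^n is spread over the n points.\<close>
  also have "\<dots> \<le> (\<Sum>\<kappa>\<in>K. \<Prod>v\<in>S. path_weight (\<kappa> v) * y ^ \<kappa> v / y)"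
  proof (rule sum_mono)
    fix \<kappa> assume "\<kappa> \<in> K"
    then have le: "(\<Sum>v\<in>S. \<kappa> v) \<le> ?n" by (simp add: K_def)
    have W: "0 \<le> (\<Prod>v\<in>S. path_weight (\<kappa> v))" by (intro prod_nonneg) (auto simp: path_weight_def)
    have "y ^ ?n \<le> y ^ (\<Sum>v\<in>S. \<kappa> v)" using le y by (intro power_decreasing) auto
    then have "1 \<le> y ^ (\<Sum>v\<in>S. \<kappa> v) / y ^ ?n" using y by simp
    then have "(\<Prod>v\<in>S. path_weight (\<kappa> v)) * 1 \<le> (\<Prod>v\<in>S. path_weight (\<kappa> v)) * (y ^ (\<Sum>v\<in>S. \<kappa> v) / y ^ ?n)"
      using W by (intro mult_left_mono)
    also have "\<dots> = (\<Prod>v\<in>S. path_weight (\<kappa> v) * y ^ \<kappa> v / y)"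
      by (simp add: prod_dividef prod.distrib power_sum)
    finally show "(\<Prod>v\<in>S. path_weight (\<kappa> v)) \<le> (\<Prod>v\<in>S. path_weight (\<kappa> v) * y ^ \<kappa> v / y)" by simp
  qed
  \<comment> \<open>Dropping the condition on the total adds nonnegative terms and makes the points
    independent, so the sum of products becomes a product of sums.\<close>
  also have "\<dots> \<le> (\<Sum>\<kappa>\<in>Pi\<^sub>E S (\<lambda>_. A). \<Prod>v\<in>S. path_weight (\<kappa> v) * y ^ \<kappa> v / y)"
    using y by (intro sum_mono2[OF finP] prod_nonneg) (auto simp: K_def path_weight_def)
  also have "\<dots> = (\<Prod>v\<in>S. \<Sum>k\<in>A. path_weight k * y ^ k / y)"
    by (rule prod_sum_PiE[symmetric]) (use fin in \<open>auto simp: A_def\<close>)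
  also have "\<dots> = (\<Sum>k\<in>A. path_weight k * y ^ k / y) ^ ?n" by simp
  also have "\<dots> \<le> ((1 + (2 * y / (1 - 2 * y)\<^sup>2 - 2 * y) / 8) / y) ^ ?n"
  proof (rule power_mono)
    show "0 \<le> (\<Sum>k\<in>A. path_weight k * y ^ k / y)" using y by (intro sum_nonneg) (auto simp: path_weight_def)
    have "(\<Sum>k\<in>A. path_weight k * y ^ k / y) = (\<Sum>k\<in>A. path_weight k * y ^ k) / y"
      by (simp add: sum_divide_distrib)
    also have "(\<Sum>k\<in>A. path_weight k * y ^ k) = 1 + (\<Sum>k\<in>{2..?n}. path_weight k * y ^ k)"
      by (simp add: A_def path_weight_def)
    also have "(\<Sum>k\<in>{2..?n}. path_weight k * y ^ k) = (\<Sum>k\<in>{2..?n}. real k * (2 * y) ^ k) / 8"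
      unfolding sum_divide_distrib by (intro sum.cong) (auto simp: path_weight_def power_mult_distrib)
    also have "(1 + \<dots>) / y \<le> (1 + (2 * y / (1 - 2 * y)\<^sup>2 - 2 * y) / 8) / y"
      using sum_arith_geometric_le[of "2 * y" ?n] y by (intro divide_right_mono) auto
    finally show "(\<Sum>k\<in>A. path_weight k * y ^ k / y) \<le> (1 + (2 * y / (1 - 2 * y)\<^sup>2 - 2 * y) / 8) / y" .
  qed
  finally show ?thesis .
qed

text \<open>The bound is already a pure n-th power, so the polynomial factor can be taken as
  1.\<close>

theorem theorem2:
  shows "\<exists>(C::real) (k::nat). \<forall>S::point set. finite S \<and> convex_position S \<longrightarrow>
           real (card {E. ncpws S E}) \<le> C * (real (card S) + 1) ^ k * (4.610718614::real) ^ card S"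
proof (rule exI[of _ 1], rule exI[of _ 0], intro allI impI)
  fix S :: "point set" assume S: "finite S \<and> convex_position S"
  \<comment> \<open>close to the minimiser, the root of (1 - 2 y)^3 = y^2\<close>
  let ?y = "0.2839796 :: real"
  have "real (card {E. ncpws S E}) \<le> ((1 + (2 * ?y / (1 - 2 * ?y)\<^sup>2 - 2 * ?y) / 8) / ?y) ^ card S"
    using S by (intro card_ncpws_le) auto
  \<comment> \<open>The base in the theorem is the minimum rounded up in the ninth decimal; this
    slack absorbs the rounding of \<open>?y\<close>.\<close>
  also have "\<dots> \<le> 4.610718614 ^ card S"
    by (intro power_mono) (simp_all add: power2_eq_square)
  finally show "real (card {E. ncpws S E}) \<le> 1 * (real (card S) + 1) ^ 0 * 4.610718614 ^ card S"
    by simp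
qed

end
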